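(* Let $X$ be a normed space and let $\mathcal{C},\mathcal{K}\subset X$ be (non-trivial) cones. The following assertions are equivalent. (i) $(\mathcal{C},\mathcal{K})$ has the strict separation property (SSP). (ii) There exist $\delta_2>\delta_1>0$ and $f\in X^*$ such that, for every $\alpha\in(\delta_1,\delta_2)$, $(f,\alpha)\in\mathcal{C}^{a\#}_+$ and $0<f(y)+\alpha\|y\|$ for every $y\in \mathrm{bd}(-\mathcal{K})$, $y\neq 0_X$. (iii) There exist $\delta_2>\delta_1>0$ and $f\in X^*$ such that, for every $\alpha\in(\delta_1,\delta_2)$, $(f,\alpha)\in\mathcal{C}^{a\#}_+$ and $f(x)+\alpha\|x\|<0<f(y)+\alpha\|y\|$ for every $x\in-\overline{\mathrm{co}}(\mathcal{C})$, $x\neq 0_X$, and every $y\in\mathrm{bd}(-\mathcal{K})$, $y\neq 0_X$.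
   Context: $X$ is a real normed space with origin $0_X$, dual $X^*$ and unit sphere $S_X=\{x\in X:\|x\|=1\}$. For $S\subset X$: $\overline S$ is the closure, $\mathrm{bd}(S)$ the boundary, $\mathrm{co}(S)$ the convex hull, $\overline{\mathrm{co}}(S)$ the closure of the convex hull, and $S_0:=S\cup\{0_X\}$. A cone is a set $\mathcal{C}\subset X$ with $\lambda x\in\mathcal{C}$ for all $\lambda\ge0$, $x\in\mathcal{C}$ (not necessarily convex or closed); all cones are assumed non-trivial: $\{0_X\}\subsetneq\mathcal{C}\subsetneq X$. For a cone $\mathcal{C}$, $\mathcal{C}_{\wedge}:=\mathrm{co}(\mathcal{C}\cap S_X)$ and $\mathcal{C}_{\vee}:=\mathrm{co}((\mathrm{bd}(\mathcal{C})\cap S_X)_0)$. The pair of cones $(\mathcal{C},\mathcal{K})$ has the strict separation property (SSP) if $0_X\notin\overline{\mathcal{C}_{\wedge}-\mathcal{K}_{\vee}}$ (Minkowski difference). $\mathcal{C}^{\#}:=\{f\in X^*: f(x)>0\ \forall x\in\mathcal{C},\ x\neq0_X\}$ and $\mathcal{C}^{a\#}_+:=\{(f,\alpha)\in\mathcal{C}^{\#}\times(0,\infty): f(x)-\alpha\|x\|>0\ \forall x\in\mathcal{C},\ x\neq0_X\}$. *)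

theory Defs
  imports "HOL-Analysis.Analysis"
begin

text \<open>The library's \<^const>\<open>cone\<close> allows scaling by \<open>c = 0\<close>, and requires neither convexity nor closedness.\<close>

definition nontrivial_cone :: "'a::real_normed_vector set \<Rightarrow> bool" where
  "nontrivial_cone C \<longleftrightarrow> cone C \<and> {0} \<subset> C \<and> C \<subset> UNIV"

definition cone_wedge :: "'a::real_normed_vector set \<Rightarrow> 'a set" where
  "cone_wedge C = convex hull (C \<inter> sphere 0 1)"

definition cone_vee :: "'a::real_normed_vector set \<Rightarrow> 'a set" where
  "cone_vee C = convex hull (insert 0 (frontier C \<inter> sphere 0 1))"

definition SSP :: "'a::real_normed_vector set \<Rightarrow> 'a set \<Rightarrow> bool" where
  "SSP C K \<longleftrightarrow> 0 \<notin> closure {x - y | x y. x \<in> cone_wedge C \<and> y \<in> cone_vee K}"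

definition dual_sharp :: "'a::real_normed_vector set \<Rightarrow> ('a \<Rightarrow>\<^sub>L real) set" where
  "dual_sharp C = {f. \<forall>x\<in>C. x \<noteq> 0 \<longrightarrow> blinfun_apply f x > 0}"

definition aug_dual_sharp :: "'a::real_normed_vector set \<Rightarrow> (('a \<Rightarrow>\<^sub>L real) \<times> real) set" where
  "aug_dual_sharp C = {(f, \<alpha>). f \<in> dual_sharp C \<and> 0 < \<alpha> \<and>
     (\<forall>x\<in>C. x \<noteq> 0 \<longrightarrow> blinfun_apply f x - \<alpha> * norm x > 0)}"

end

theory Submission
  imports Defs
begin

text \<open>
  A functional strictly separating \<open>cone_wedge C\<close> from \<open>cone_vee K\<close> is at least some \<open>t\<close> on the
  unit vectors of \<open>C\<close> and at most some \<open>s < t\<close> on those of \<open>frontier K\<close>, where \<open>s \<ge> 0\<close> because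
  \<open>0 \<in> cone_vee K\<close>. By homogeneity, \<open>f - \<alpha> * norm\<close> then has the required signs for
  \<open>s < \<alpha> < t\<close>; as this function is concave and continuous, its sign on \<open>C\<close> carries
  over to the closed convex hull. Conversely, letting \<open>\<alpha>\<close> tend to the ends of the interval gives such
  bounds on the unit vectors. Strict separation in a normed space comes from the Hahn-Banach theorem,
  proved here by showing that minimal sublinear functionals are linear.
\<close>

section \<open>Sublinear functionals and the Hahn-Banach theorem\<close>

definition sublinear :: "('a::real_vector \<Rightarrow> real) \<Rightarrow> bool" where
  "sublinear p \<longleftrightarrow> (\<forall>x y. p (x + y) \<le> p x + p y) \<and> (\<forall>c>0. \<forall>x. p (c *\<^sub>R x) \<le> c * p x)"

lemma sublinear_add: "sublinear p \<Longrightarrow> p (x + y) \<le> p x + p y"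
  by (simp add: sublinear_def)

lemma sublinear_scale_le: "sublinear p \<Longrightarrow> c > 0 \<Longrightarrow> p (c *\<^sub>R x) \<le> c * p x"
  by (simp add: sublinear_def)

lemma sublinear_zero:
  assumes "sublinear p"
  shows "p 0 = 0"
  \<comment> \<open>Subadditivity gives \<open>p 0 >= 0\<close>; scaling by \<open>1/2\<close> gives
    \<open>p 0 <= 0\<close>.\<close>
  using sublinear_add[OF assms, of 0 0] sublinear_scale_le[OF assms, of "1/2" 0] by simp

text \<open>Scaling back by \<open>1/c\<close> reverses the inequality. The definition can therefore
  ask for one direction with \<open>c > 0\<close>, which is all that the infima below have to
  verify.\<close>

lemma sublinear_scale:
  assumes "sublinear p" "c \<ge> 0"
  shows "p (c *\<^sub>R x) = c * p x"
proof (cases "c = 0")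
  case True
  then show ?thesis by (simp add: sublinear_zero[OF assms(1)])
next
  case False
  with assms have c: "c > 0" by simp
  have "p ((1/c) *\<^sub>R (c *\<^sub>R x)) \<le> (1/c) * p (c *\<^sub>R x)"
    using c by (intro sublinear_scale_le[OF assms(1)]) simp
  then have "c * p x \<le> p (c *\<^sub>R x)"
    using c by (simp add: field_simps)
  with sublinear_scale_le[OF assms(1) c, of x] show ?thesis by simp
qed

lemma sublinear_minus_le:
  assumes "sublinear p"
  shows "- p (- x) \<le> p x"
  using sublinear_add[OF assms, of x "- x"] by (simp add: sublinear_zero[OF assms])

text \<open>For fixed \<open>b\<close>, \<open>z - g b\<close> is a lower bound of \<open>f\<close>;
  taking infima one after the other gives the claim. It reduces subadditivity of a pointwise infimum
  to an estimate for pairs of members.\<close>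

lemma le_cINF_add:
  fixes f :: "'b \<Rightarrow> real" and g :: "'c \<Rightarrow> real"
  assumes "A \<noteq> {}" "B \<noteq> {}" "\<And>a b. a \<in> A \<Longrightarrow> b \<in> B \<Longrightarrow> z \<le> f a + g b"
  shows "z \<le> (INF a\<in>A. f a) + (INF b\<in>B. g b)"
proof -
  have "z - g b \<le> (INF a\<in>A. f a)" if "b \<in> B" for b
    using assms that by (intro cINF_greatest) (auto simp: algebra_simps)
  then have "z - (INF a\<in>A. f a) \<le> (INF b\<in>B. g b)"
    using assms by (intro cINF_greatest) (auto simp: algebra_simps)
  then show ?thesis by simp
qed

text \<open>
  The functional is \<open>q' x = inf {q (x + t d) - t r | t \<ge> 0, d \<in> D}\<close>. With \<open>D = {y}\<close> and
  \<open>r = q y\<close> it shows that a minimal \<open>q\<close> is odd; with \<open>q = norm\<close> it yields separation of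
  \<open>D\<close> from \<open>0\<close>.
\<close>

lemma sublinear_tilt:
  fixes q :: "'a::real_vector \<Rightarrow> real"
  assumes q: "sublinear q" and D: "convex D" and r: "\<And>d. d \<in> D \<Longrightarrow> r \<le> q d"
  shows "\<exists>q'. sublinear q' \<and> (\<forall>x. q' x \<le> q x) \<and> (\<forall>d\<in>D. q' (- d) \<le> - r)"
proof (cases "D = {}")
  case True
  with q show ?thesis by auto
next
  case False
  define T where "T = {0::real..} \<times> D"
  define g where "g = (\<lambda>x (t, d). q (x + t *\<^sub>R d) - t * r)"
  define q' where "q' = (\<lambda>x. INF td\<in>T. g x td)"
  have T: "T \<noteq> {}" using False by (auto simp: T_def)
  \<comment> \<open>The bound does not depend on \<open>t\<close> and \<open>d\<close>, so the
    infimum \<open>q' x\<close> is taken over a set bounded below.\<close>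
  have "- q (- x) \<le> g x td" if "td \<in> T" for x td
  proof -
    obtain t d where td: "td = (t, d)" "t \<ge> 0" "d \<in> D"
      using \<open>td \<in> T\<close> by (cases td) (auto simp: T_def)
    have "t * r \<le> t * q d" using td r by (simp add: mult_left_mono)
    also have "\<dots> = q ((x + t *\<^sub>R d) + - x)" using td q by (simp add: sublinear_scale)
    also have "\<dots> \<le> q (x + t *\<^sub>R d) + q (- x)" by (rule sublinear_add[OF q])
    finally show ?thesis by (simp add: g_def td)
  qed
  then have bdd: "bdd_below (g x ` T)" for x by (rule bdd_belowI2)
  have le: "q' x \<le> q (x + t *\<^sub>R d) - t * r" if "t \<ge> 0" "d \<in> D" for x t d
    using cINF_lower[OF bdd, of "(t, d)" x] that by (simp add: q'_def g_def T_def)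
  have "q' (x + y) \<le> q' x + q' y" for x y
    unfolding q'_def[THEN fun_cong, of x] q'_def[THEN fun_cong, of y]
  proof (rule le_cINF_add[OF T T])
    fix a b assume "a \<in> T" "b \<in> T"
    then obtain s d t e where a: "a = (s, d)" "s \<ge> 0" "d \<in> D" and b: "b = (t, e)" "t \<ge> 0" "e \<in> D"
      by (auto simp: T_def)
    \<comment> \<open>Convexity merges the two shifts into one: \<open>u\<close> is the mean of
      \<open>d\<close> and \<open>e\<close> with weights proportional to \<open>s\<close> and
      \<open>t\<close>. If both weights vanish, any point of \<open>D\<close> serves.\<close>
    obtain u where u: "u \<in> D" "(s + t) *\<^sub>R u = s *\<^sub>R d + t *\<^sub>R e"
    proof (cases "s + t = 0")
      case True
      then have "s = 0" "t = 0" using a b by linarith+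
      then show ?thesis using that[of d] a by simp
    next
      case False
      then have pos: "s + t > 0" using a b by linarith
      define u where "u = (s / (s + t)) *\<^sub>R d + (t / (s + t)) *\<^sub>R e"
      have "u \<in> D"
        unfolding u_def using a b pos
        by (intro convexD[OF D]) (auto simp: add_divide_distrib[symmetric])
      moreover have "(s + t) *\<^sub>R u = s *\<^sub>R d + t *\<^sub>R e"
        using pos by (simp add: u_def scaleR_add_right)
      ultimately show ?thesis using that by blast
    qed
    have "q' (x + y) \<le> q ((x + y) + (s + t) *\<^sub>R u) - (s + t) * r"
      using a b u by (intro le) auto
    also have "(x + y) + (s + t) *\<^sub>R u = (x + s *\<^sub>R d) + (y + t *\<^sub>R e)"
      by (simp only: u(2) ac_simps)
    also have "q \<dots> \<le> q (x + s *\<^sub>R d) + q (y + t *\<^sub>R e)" by (rule sublinear_add[OF q])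
    finally show "q' (x + y) \<le> g x a + g y b"
      by (simp add: g_def a b algebra_simps)
  qed
  moreover have "q' (c *\<^sub>R x) \<le> c * q' x" if c: "c > 0" for c x
  proof -
    have "q' (c *\<^sub>R x) / c \<le> q' x"
      unfolding q'_def[THEN fun_cong, of x]
    proof (rule cINF_greatest[OF T])
      fix a assume "a \<in> T"
      then obtain s d where a: "a = (s, d)" "s \<ge> 0" "d \<in> D" by (auto simp: T_def)
      \<comment> \<open>The pair \<open>(s, d)\<close> in the infimum at \<open>x\<close>
        corresponds to \<open>(c * s, d)\<close> in the infimum at the scaled point.\<close>
      have "q' (c *\<^sub>R x) \<le> q (c *\<^sub>R x + (c * s) *\<^sub>R d) - (c * s) * r"
        using a c by (intro le) auto
      also have "c *\<^sub>R x + (c * s) *\<^sub>R d = c *\<^sub>R (x + s *\<^sub>R d)" by (simp add: algebra_simps)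
      also have "q \<dots> = c * q (x + s *\<^sub>R d)" using q c by (simp add: sublinear_scale)
      finally show "q' (c *\<^sub>R x) / c \<le> g x a"
        using c by (simp add: g_def a field_simps)
    qed
    then show ?thesis using c by (simp add: field_simps)
  qed
  ultimately have "sublinear q'" by (simp add: sublinear_def)
  \<comment> \<open>The choice \<open>t = 0\<close> gives this bound; \<open>t = 1\<close> at
    \<open>- d\<close> gives the next one, since \<open>q 0 = 0\<close>.\<close>
  moreover have "q' x \<le> q x" for x
    using False le[of 0 _ x] by auto
  moreover have "q' (- d) \<le> - r" if "d \<in> D" for d
    using le[of 1 d "- d"] that by (simp add: sublinear_zero[OF q])
  ultimately show ?thesis by blast
qed

text \<open>Zorn's lemma for the sublinear functionals below \<open>p\<close>, ordered by
  \<open>\<ge>\<close> so that maximal means minimal. A nonempty chain is bounded by its pointwise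
  infimum, which is again sublinear.\<close>

lemma exists_minimal_sublinear:
  fixes p :: "'a::real_vector \<Rightarrow> real"
  assumes p: "sublinear p"
  shows "\<exists>q. sublinear q \<and> (\<forall>x. q x \<le> p x) \<and>
    (\<forall>q'. sublinear q' \<longrightarrow> (\<forall>x. q' x \<le> q x) \<longrightarrow> q' = q)"
proof -
  define A where "A = {q. sublinear q \<and> q \<le> p}"
  have "\<exists>m\<in>A. \<forall>a\<in>A. m \<ge> a \<longrightarrow> a = m"
  proof (rule predicate_Zorn)
    show "partial_order_on A (relation_of (\<ge>) A)"
      by (rule partial_order_on_relation_ofI) auto
  next
    fix C assume "C \<in> Chains (relation_of (\<ge>) A)"
    then have CA: "C \<subseteq> A" and chain: "\<And>a b. a \<in> C \<Longrightarrow> b \<in> C \<Longrightarrow> a \<le> b \<or> b \<le> a"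
      by (auto simp: Chains_def relation_of_def)
    show "\<exists>u\<in>A. \<forall>a\<in>C. a \<ge> u"
    proof (cases "C = {}")
      case True
      with p show ?thesis by (auto simp: A_def)
    next
      case False
      define u where "u = (\<lambda>x. INF q\<in>C. q x)"
      \<comment> \<open>A bound common to all members of the chain keeps the pointwise infimum
        finite.\<close>
      have "- p (- x) \<le> q x" if "q \<in> C" for q x
      proof -
        have "sublinear q" "q (- x) \<le> p (- x)" using that CA by (auto simp: A_def le_fun_def)
        then show ?thesis using sublinear_minus_le[of q x] by linarith
      qed
      then have "bdd_below ((\<lambda>q. q x) ` C)" for x by (rule bdd_belowI2)
      then have le: "u x \<le> q x" if "q \<in> C" for q x
        using that by (auto simp: u_def intro: cINF_lower)
      have "u (x + y) \<le> u x + u y" for x y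
        unfolding u_def[THEN fun_cong, of x] u_def[THEN fun_cong, of y]
      proof (rule le_cINF_add[OF False False])
        fix a b assume ab: "a \<in> C" "b \<in> C"
        \<comment> \<open>The members nearly attaining the infimum at \<open>x\<close> and at
          \<open>y\<close> may differ; in a chain the smaller one serves for both.\<close>
        then obtain m where m: "m \<in> C" "m \<le> a" "m \<le> b" using chain by blast
        have "u (x + y) \<le> m (x + y)" by (rule le[OF m(1)])
        also have "\<dots> \<le> m x + m y" using m CA by (auto simp: A_def intro: sublinear_add)
        also have "\<dots> \<le> a x + b y" using m by (auto simp: le_fun_def intro: add_mono)
        finally show "u (x + y) \<le> a x + b y" .
      qed
      moreover have "u (c *\<^sub>R x) \<le> c * u x" if c: "c > 0" for c x
      proof -
        have "u (c *\<^sub>R x) / c \<le> u x"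
          unfolding u_def[THEN fun_cong, of x]
        proof (rule cINF_greatest[OF False])
          fix a assume a: "a \<in> C"
          then have "a (c *\<^sub>R x) = c * a x" using CA c by (auto simp: A_def sublinear_scale)
          then show "u (c *\<^sub>R x) / c \<le> a x" using le[OF a, of "c *\<^sub>R x"] c by (simp add: field_simps)
        qed
        then show ?thesis using c by (simp add: field_simps)
      qed
      ultimately have "sublinear u" by (simp add: sublinear_def)
      moreover have "u \<le> p"
      proof -
        obtain a where a: "a \<in> C" using False by blast
        then have "u \<le> a" using le by (simp add: le_fun_def)
        also have "a \<le> p" using a CA by (auto simp: A_def)
        finally show ?thesis .
      qed
      ultimately show ?thesis using le by (intro bexI[of _ u]) (auto simp: A_def le_fun_def)
    qed
  qed
  then obtain m where m: "sublinear m" "m \<le> p" and min: "\<And>a. sublinear a \<Longrightarrow> a \<le> p \<Longrightarrow> a \<le> m \<Longrightarrow> a = m"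
    by (auto simp: A_def)
  show ?thesis
  proof (intro exI[of _ m] conjI allI impI)
    fix q' assume q': "sublinear q'" "\<forall>x. q' x \<le> m x"
    then have qm: "q' \<le> m" by (simp add: le_fun_def)
    show "q' = m" by (rule min[OF q'(1) order_trans[OF qm m(2)] qm])
  qed (use m in \<open>auto simp: le_fun_def\<close>)
qed

text \<open>Tilting a minimal sublinear functional along a single vector cannot lower it, which
  makes it odd; an odd sublinear functional is linear.\<close>

theorem Hahn_Banach_sublinear:
  fixes p :: "'a::real_vector \<Rightarrow> real"
  assumes "sublinear p"
  shows "\<exists>f. linear f \<and> (\<forall>x. f x \<le> p x)"
proof -
  obtain q where q: "sublinear q" and qp: "\<And>x. q x \<le> p x"
    and min: "\<And>q'. sublinear q' \<Longrightarrow> (\<And>x. q' x \<le> q x) \<Longrightarrow> q' = q"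
    using exists_minimal_sublinear[OF assms] by blast
  have "q (- y) \<le> - q y" for y
  proof -
    obtain q' where "sublinear q'" "\<And>x. q' x \<le> q x" "q' (- y) \<le> - q y"
      using sublinear_tilt[OF q, of "{y}" "q y"] by auto
    \<comment> \<open>Minimality forces \<open>q' = q\<close>, so the bound on the tilted functional
      holds for \<open>q\<close> itself.\<close>
    then show ?thesis using min by blast
  qed
  then have odd: "q (- y) = - q y" for y
    using sublinear_minus_le[OF q, of y] by (simp add: order_antisym)
  have "linear q"
  proof (rule linearI)
    fix x y
    have "q x \<le> q (x + y) - q y"
      using sublinear_add[OF q, of "x + y" "- y"] odd[of y] by simp
    then show "q (x + y) = q x + q y"
      using sublinear_add[OF q, of x y] by simp
  next
    fix c :: real and x
    show "q (c *\<^sub>R x) = c *\<^sub>R q x"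
    proof (cases "c \<ge> 0")
      case True
      then show ?thesis by (simp add: sublinear_scale[OF q])
    next
      case False
      then show ?thesis
        using sublinear_scale[OF q, of "- c" x] odd[of "c *\<^sub>R x"] by simp
    qed
  qed
  with qp show ?thesis by blast
qed

text \<open>The norm tilted along \<open>D\<close> stays below the norm and is at most
  \<open>- r\<close> on \<open>- D\<close>. A linear functional below it is thus bounded and at
  least \<open>r\<close> on \<open>D\<close>, where \<open>r\<close> is the radius of a ball about
  \<open>0\<close> missing \<open>D\<close>.\<close>

corollary separate_convex_zero:
  fixes D :: "'a::real_normed_vector set"
  assumes D: "convex D" and 0: "0 \<notin> closure D"
  shows "\<exists>(f :: 'a \<Rightarrow>\<^sub>L real) c. c > 0 \<and> (\<forall>d\<in>D. c \<le> f d)"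
proof -
  obtain r where r: "r > 0" "\<And>d. d \<in> D \<Longrightarrow> r \<le> norm d"
    using 0 by (force simp: closure_approachable not_less)
  have "sublinear (norm :: 'a \<Rightarrow> real)"
    by (simp add: sublinear_def norm_triangle_ineq)
  from sublinear_tilt[OF this D r(2)] obtain p where
    p: "sublinear p" "\<And>x. p x \<le> norm x" "\<And>d. d \<in> D \<Longrightarrow> p (- d) \<le> - r" by blast
  obtain f where f: "linear f" "\<And>x. f x \<le> p x"
    using Hahn_Banach_sublinear[OF p(1)] by blast
  have neg: "f (- x) = - f x" for x by (rule linear_neg[OF f(1)])
  have "\<bar>f x\<bar> \<le> norm x" for x
    using f(2)[of x] p(2)[of x] f(2)[of "- x"] p(2)[of "- x"] neg[of x] by simp
  then have "bounded_linear f"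
    using f(1) by (intro bounded_linear_intro[of _ 1])
      (auto simp: linear_add linear_scale)
  then have "blinfun_apply (Blinfun f) = f" by (rule bounded_linear_Blinfun_apply)
  moreover have "r \<le> f d" if "d \<in> D" for d
    using f(2)[of "- d"] p(3)[OF that] neg[of d] by simp
  ultimately show ?thesis using r(1) by metis
qed

section \<open>Frontiers of cones and bounds on closed convex hulls\<close>

lemma frontier_scaleR_image:
  fixes S :: "'a::real_normed_vector set"
  assumes "c \<noteq> 0"
  shows "frontier ((*\<^sub>R) c ` S) = (*\<^sub>R) c ` frontier S"
proof -
  have inj: "inj ((*\<^sub>R) c :: 'a \<Rightarrow> 'a)" using assms by (intro injI) simp
  have "surj ((*\<^sub>R) c :: 'a \<Rightarrow> 'a)"
    using assms by (intro surjI[of _ "\<lambda>x. (1/c) *\<^sub>R x"]) simp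
  \<comment> \<open>A bijection commutes with complements, and the frontier is the intersection of
    the closures of a set and of its complement.\<close>
  with inj have "- ((*\<^sub>R) c ` S) = (*\<^sub>R) c ` (- S)"
    by (simp add: bij_image_Compl_eq bij_def)
  then show ?thesis
    by (simp add: frontier_closures closure_scaleR[symmetric] image_Int[OF inj])
qed

lemma frontier_uminus_image:
  fixes S :: "'a::real_normed_vector set"
  shows "frontier (uminus ` S) = uminus ` frontier S"
  using frontier_scaleR_image[of "- 1" S] by simp

text \<open>Scaling by \<open>c > 0\<close> maps the cone onto itself, hence also its frontier. This
  allows vectors of the frontier to be normalised.\<close>

lemma cone_frontier_scaleR:
  fixes K :: "'a::real_normed_vector set"
  assumes K: "cone K" and c: "c > 0" and y: "y \<in> frontier K"
  shows "c *\<^sub>R y \<in> frontier K"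
proof -
  have "K = (*\<^sub>R) c ` K"
  proof
    show "(*\<^sub>R) c ` K \<subseteq> K" using K c by (auto simp: cone_def)
    show "K \<subseteq> (*\<^sub>R) c ` K"
    proof
      fix x assume "x \<in> K"
      then have "(1/c) *\<^sub>R x \<in> K" using K c by (auto simp: cone_def)
      then show "x \<in> (*\<^sub>R) c ` K" using c by (intro image_eqI[of _ _ "(1/c) *\<^sub>R x"]) auto
    qed
  qed
  then have "frontier K = (*\<^sub>R) c ` frontier K"
    using frontier_scaleR_image[of c K] c by simp
  with y show ?thesis by blast
qed

text \<open>The set where the inequality holds is convex, by the triangle inequality and
  \<open>b \<ge> 0\<close>, and closed by continuity, so it contains the closed convex hull once it
  contains \<open>C\<close>.\<close>

lemma cone_closure_hull_bound:
  fixes f :: "'a::real_normed_vector \<Rightarrow>\<^sub>L real"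
  assumes "\<And>x. x \<in> C \<Longrightarrow> b * norm x \<le> f x" "b \<ge> 0" "z \<in> closure (convex hull C)"
  shows "b * norm z \<le> f z"
proof -
  define S where "S = {x. b * norm x \<le> f x}"
  have "convex S"
  proof (rule convexI)
    fix x y and u v :: real
    assume "x \<in> S" "y \<in> S" and uv: "u \<ge> 0" "v \<ge> 0"
    then have xy: "b * norm x \<le> f x" "b * norm y \<le> f y" by (auto simp: S_def)
    have "b * norm (u *\<^sub>R x + v *\<^sub>R y) \<le> b * (u * norm x + v * norm y)"
      using norm_triangle_ineq[of "u *\<^sub>R x" "v *\<^sub>R y"] uv assms(2)
      by (intro mult_left_mono) auto
    also have "\<dots> = u * (b * norm x) + v * (b * norm y)" by (simp add: algebra_simps)
    also have "\<dots> \<le> u * f x + v * f y" using xy uv by (intro add_mono mult_left_mono)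
    finally show "u *\<^sub>R x + v *\<^sub>R y \<in> S"
      by (simp add: S_def blinfun.add_right blinfun.scaleR_right)
  qed
  then have "convex hull C \<subseteq> S" using assms(1) by (intro hull_minimal) (auto simp: S_def)
  moreover have "closed S" unfolding S_def
    by (intro closed_Collect_le continuous_intros)
  ultimately show ?thesis using assms(3) closure_minimal[of "convex hull C" S] by (auto simp: S_def)
qed

section \<open>Strict separation as a pair of bounds on a functional\<close>

text \<open>Separating the convex difference set from \<open>0\<close> leaves a gap \<open>c\<close>
  between the values of \<open>f\<close> on the generators of the two hulls. Homogeneity turns the
  bounds on unit vectors into the slopes \<open>s\<close> and \<open>t = s + c\<close>.\<close>

lemma SSP_imp_bounds:
  fixes C K :: "'a::real_normed_vector set"
  assumes C: "cone C" "C \<inter> sphere 0 1 \<noteq> {}" and K: "cone K" and ssp: "SSP C K"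
  shows "\<exists>(f :: 'a \<Rightarrow>\<^sub>L real) s t. 0 \<le> s \<and> s < t \<and>
    (\<forall>x\<in>closure (convex hull C). t * norm x \<le> f x) \<and> (\<forall>y\<in>frontier K. f y \<le> s * norm y)"
proof -
  define D where "D = {x - y | x y. x \<in> cone_wedge C \<and> y \<in> cone_vee K}"
  \<comment> \<open>The difference set in the form used by
    \<open>convex_differences\<close>.\<close>
  have "D = (\<Union>x\<in>cone_wedge C. \<Union>y\<in>cone_vee K. {x - y})" by (auto simp: D_def)
  then have "convex D"
    by (simp add: cone_wedge_def cone_vee_def convex_differences)
  moreover have "0 \<notin> closure D" using ssp by (simp add: SSP_def D_def)
  ultimately obtain f :: "'a \<Rightarrow>\<^sub>L real" and c where c: "c > 0" and f: "\<And>d. d \<in> D \<Longrightarrow> c \<le> f d"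
    using separate_convex_zero by blast
  define Y where "Y = insert 0 (frontier K \<inter> sphere 0 1)"
  have sep: "f y + c \<le> f x" if "x \<in> C" "norm x = 1" "y \<in> Y" for x y
  proof -
    have "x \<in> cone_wedge C" "y \<in> cone_vee K"
      using that by (auto simp: cone_wedge_def cone_vee_def Y_def intro!: hull_inc)
    then have "x - y \<in> D" by (auto simp: D_def)
    from f[OF this] show ?thesis by (simp add: blinfun.diff_right)
  qed
  \<comment> \<open>Since \<open>Y\<close> contains \<open>0\<close>, this supremum is nonnegative;
    any unit vector of \<open>C\<close> shows that it is finite.\<close>
  define s where "s = (SUP y\<in>Y. f y)"
  obtain x0 where x0: "x0 \<in> C" "norm x0 = 1" using C by auto
  have "f y \<le> f x0 - c" if "y \<in> Y" for y using sep[OF x0 that] by simp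
  then have "bdd_above (f ` Y)" by (rule bdd_aboveI2)
  then have s: "f y \<le> s" if "y \<in> Y" for y using that by (auto simp: s_def intro: cSUP_upper)
  have Y: "0 \<in> Y" by (simp add: Y_def)
  have s0: "0 \<le> s" using s[OF Y] by (simp add: blinfun.zero_right)
  \<comment> \<open>The gap \<open>c\<close> is uniform in \<open>y\<close>, so it survives the
    supremum.\<close>
  have sx: "s + c \<le> f x" if "x \<in> C" "norm x = 1" for x
  proof -
    have "s \<le> f x - c" unfolding s_def
      using Y sep[OF that] by (intro cSUP_least) (auto simp: algebra_simps)
    then show ?thesis by simp
  qed
  have "(s + c) * norm x \<le> f x" if x: "x \<in> C" for x
  proof (cases "x = 0")
    case False
    have "(1 / norm x) *\<^sub>R x \<in> C" using C x by (auto simp: cone_def)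
    from sx[OF this] False show ?thesis by (simp add: blinfun.scaleR_right field_simps)
  qed (simp add: blinfun.zero_right)
  with s0 c have "\<forall>x\<in>closure (convex hull C). (s + c) * norm x \<le> f x"
    using cone_closure_hull_bound[of C "s + c" f] by simp
  moreover have "f y \<le> s * norm y" if y: "y \<in> frontier K" for y
  proof (cases "y = 0")
    case False
    have "(1 / norm y) *\<^sub>R y \<in> frontier K" using False by (intro cone_frontier_scaleR K y) auto
    then have "(1 / norm y) *\<^sub>R y \<in> Y" using False by (simp add: Y_def)
    from s[OF this] False show ?thesis by (simp add: blinfun.scaleR_right field_simps)
  qed (simp add: blinfun.zero_right)
  ultimately show ?thesis using s0 c by (intro exI[of _ f] exI[of _ s] exI[of _ "s + c"]) auto
qed

text \<open>Half-spaces are convex, so the bounds pass to both hulls, with \<open>0 \<le> s\<close>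
  covering the added origin. All differences then lie in the closed half-space
  \<open>f \<ge> t - s\<close>, which misses \<open>0\<close>.\<close>

lemma SSP_if_bounds:
  fixes C K :: "'a::real_normed_vector set" and f :: "'a \<Rightarrow>\<^sub>L real"
  assumes st: "0 \<le> s" "s < t"
    and C: "\<And>x. x \<in> C \<Longrightarrow> norm x = 1 \<Longrightarrow> t \<le> f x"
    and K: "\<And>y. y \<in> frontier K \<Longrightarrow> norm y = 1 \<Longrightarrow> f y \<le> s"
  shows "SSP C K"
proof -
  have "linear f" by (intro bounded_linear.linear blinfun.bounded_linear_right)
  then have "convex (f -` {t..})" "convex (f -` {..s})"
    by (simp_all add: convex_linear_vimage)
  moreover have "C \<inter> sphere 0 1 \<subseteq> f -` {t..}" "insert 0 (frontier K \<inter> sphere 0 1) \<subseteq> f -` {..s}"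
    using C K st by (auto simp: blinfun.zero_right)
  ultimately have "cone_wedge C \<subseteq> f -` {t..}" "cone_vee K \<subseteq> f -` {..s}"
    unfolding cone_wedge_def cone_vee_def by (simp_all only: hull_minimal)
  then have "{x - y | x y. x \<in> cone_wedge C \<and> y \<in> cone_vee K} \<subseteq> {d. t - s \<le> f d}"
    by (force simp: blinfun.diff_right)
  moreover have "closed {d. t - s \<le> f d}"
    by (intro closed_Collect_le continuous_intros)
  ultimately have "closure {x - y | x y. x \<in> cone_wedge C \<and> y \<in> cone_vee K} \<subseteq> {d. t - s \<le> f d}"
    by (rule closure_minimal)
  then show ?thesis using st by (auto simp: SSP_def blinfun.zero_right)
qed

section \<open>Equivalence of strict separation with the conditions on augmented dual pairs\<close>

theorem theorem3p1:
  fixes C K :: "'a::real_normed_vector set"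
  assumes "nontrivial_cone C" and "nontrivial_cone K"
  shows "(SSP C K \<longleftrightarrow>
      (\<exists>\<delta>\<^sub>1 \<delta>\<^sub>2 :: real. \<exists>f :: 'a \<Rightarrow>\<^sub>L real. 0 < \<delta>\<^sub>1 \<and> \<delta>\<^sub>1 < \<delta>\<^sub>2 \<and>
        (\<forall>\<alpha>\<in>{\<delta>\<^sub>1<..<\<delta>\<^sub>2}. (f, \<alpha>) \<in> aug_dual_sharp C \<and>
          (\<forall>y\<in>frontier (uminus ` K). y \<noteq> 0 \<longrightarrow> 0 < blinfun_apply f y + \<alpha> * norm y))))
    \<and> (SSP C K \<longleftrightarrow>
      (\<exists>\<delta>\<^sub>1 \<delta>\<^sub>2 :: real. \<exists>f :: 'a \<Rightarrow>\<^sub>L real. 0 < \<delta>\<^sub>1 \<and> \<delta>\<^sub>1 < \<delta>\<^sub>2 \<and>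
        (\<forall>\<alpha>\<in>{\<delta>\<^sub>1<..<\<delta>\<^sub>2}. (f, \<alpha>) \<in> aug_dual_sharp C \<and>
          (\<forall>x\<in>uminus ` closure (convex hull C). \<forall>y\<in>frontier (uminus ` K).
             x \<noteq> 0 \<longrightarrow> y \<noteq> 0 \<longrightarrow>
             blinfun_apply f x + \<alpha> * norm x < 0 \<and> 0 < blinfun_apply f y + \<alpha> * norm y))))"
proof -
  let ?ii = "\<lambda>\<delta>\<^sub>1 \<delta>\<^sub>2 (f :: 'a \<Rightarrow>\<^sub>L real). 0 < \<delta>\<^sub>1 \<and> \<delta>\<^sub>1 < \<delta>\<^sub>2 \<and>
    (\<forall>\<alpha>\<in>{\<delta>\<^sub>1<..<\<delta>\<^sub>2}. (f, \<alpha>) \<in> aug_dual_sharp C \<and>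
      (\<forall>y\<in>frontier (uminus ` K). y \<noteq> 0 \<longrightarrow> 0 < f y + \<alpha> * norm y))"
  let ?iii = "\<lambda>\<delta>\<^sub>1 \<delta>\<^sub>2 (f :: 'a \<Rightarrow>\<^sub>L real). 0 < \<delta>\<^sub>1 \<and> \<delta>\<^sub>1 < \<delta>\<^sub>2 \<and>
    (\<forall>\<alpha>\<in>{\<delta>\<^sub>1<..<\<delta>\<^sub>2}. (f, \<alpha>) \<in> aug_dual_sharp C \<and>
      (\<forall>x\<in>uminus ` closure (convex hull C). \<forall>y\<in>frontier (uminus ` K).
         x \<noteq> 0 \<longrightarrow> y \<noteq> 0 \<longrightarrow> f x + \<alpha> * norm x < 0 \<and> 0 < f y + \<alpha> * norm y))"
  have cones: "cone C" "cone K" using assms by (auto simp: nontrivial_cone_def)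
  obtain x0 where x0: "x0 \<in> C" "x0 \<noteq> 0" using assms(1) by (auto simp: nontrivial_cone_def)
  then have "(1 / norm x0) *\<^sub>R x0 \<in> C \<inter> sphere 0 1" using cones by (auto simp: cone_def)
  then have ne: "C \<inter> sphere 0 1 \<noteq> {}" by blast
  have hullC: "C \<subseteq> closure (convex hull C)"
    using hull_subset closure_subset by (rule subset_trans)
  have i_iii: "\<exists>\<delta>\<^sub>1 \<delta>\<^sub>2 f. ?iii \<delta>\<^sub>1 \<delta>\<^sub>2 f" if ssp: "SSP C K"
  proof -
    obtain f :: "'a \<Rightarrow>\<^sub>L real" and s t where st: "0 \<le> s" "s < t"
      and fC: "\<And>x. x \<in> closure (convex hull C) \<Longrightarrow> t * norm x \<le> f x"
      and fK: "\<And>y. y \<in> frontier K \<Longrightarrow> f y \<le> s * norm y"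
      using SSP_imp_bounds[OF cones(1) ne cones(2) ssp] by blast
    \<comment> \<open>Since \<open>s\<close> may be \<open>0\<close>, the midpoint serves as a
      positive left end of the interval.\<close>
    define m where "m = (s + t) / 2"
    have m: "0 < m" "s < m" "m < t" using st by (auto simp: m_def)
    have "(f, \<alpha>) \<in> aug_dual_sharp C \<and>
      (\<forall>x\<in>uminus ` closure (convex hull C). \<forall>y\<in>frontier (uminus ` K).
         x \<noteq> 0 \<longrightarrow> y \<noteq> 0 \<longrightarrow> f x + \<alpha> * norm x < 0 \<and> 0 < f y + \<alpha> * norm y)"
      if \<alpha>: "\<alpha> \<in> {m<..<t}" for \<alpha>
    proof -
      have \<alpha>C: "\<alpha> * norm x < f x" if "x \<in> closure (convex hull C)" "x \<noteq> 0" for x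
      proof -
        have "\<alpha> * norm x < t * norm x" using that(2) \<alpha> by simp
        also have "\<dots> \<le> f x" by (rule fC[OF that(1)])
        finally show ?thesis .
      qed
      have \<alpha>K: "f y < \<alpha> * norm y" if "y \<in> frontier K" "y \<noteq> 0" for y
      proof -
        have "f y \<le> s * norm y" by (rule fK[OF that(1)])
        also have "\<dots> < \<alpha> * norm y" using that(2) \<alpha> m by simp
        finally show ?thesis .
      qed
      have "\<alpha> > 0" using \<alpha> m by simp
      then have "0 < f x" if "x \<in> C" "x \<noteq> 0" for x
      proof -
        have "0 < \<alpha> * norm x" using that \<open>\<alpha> > 0\<close> by simp
        also have "\<dots> < f x" using that hullC by (intro \<alpha>C) auto
        finally show ?thesis .
      qed
      with \<open>\<alpha> > 0\<close> have "(f, \<alpha>) \<in> aug_dual_sharp C"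
        using \<alpha>C hullC by (auto simp: aug_dual_sharp_def dual_sharp_def)
      \<comment> \<open>Both strict inequalities are those of \<open>\<alpha>C\<close> and
        \<open>\<alpha>K\<close> at the negated vectors; negation flips the sign of \<open>f\<close>
        and keeps the norm.\<close>
      then show ?thesis
        using \<alpha>C \<alpha>K by (fastforce simp: frontier_uminus_image blinfun.minus_right)
    qed
    with m show ?thesis by blast
  qed
  have iii_ii: "?ii \<delta>\<^sub>1 \<delta>\<^sub>2 f" if "?iii \<delta>\<^sub>1 \<delta>\<^sub>2 f" for \<delta>\<^sub>1 \<delta>\<^sub>2 f
  proof -
    \<comment> \<open>The claim about \<open>y\<close> is stated under a joint quantifier over
      nonzero \<open>x\<close>; the vector \<open>- x0\<close> instantiates it.\<close>
    have "- x0 \<in> uminus ` closure (convex hull C)" "- x0 \<noteq> 0" using x0 hullC by auto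
    with that show ?thesis by blast
  qed
  have ii_i: "SSP C K" if ii: "?ii \<delta>\<^sub>1 \<delta>\<^sub>2 f" for \<delta>\<^sub>1 \<delta>\<^sub>2 f
  proof (rule SSP_if_bounds)
    show "0 \<le> \<delta>\<^sub>1" "\<delta>\<^sub>1 < \<delta>\<^sub>2" using ii by auto
    show "\<delta>\<^sub>2 \<le> f x" if "x \<in> C" "norm x = 1" for x
    \<comment> \<open>On unit vectors \<open>f x > \<alpha>\<close> throughout the interval; let
      \<open>\<alpha>\<close> increase to its right end.\<close>
    proof (rule dense_le_bounded[of \<delta>\<^sub>1])
      show "\<delta>\<^sub>1 < \<delta>\<^sub>2" using ii by auto
      show "\<alpha> \<le> f x" if "\<delta>\<^sub>1 < \<alpha>" "\<alpha> < \<delta>\<^sub>2" for \<alpha>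
      proof -
        have "(f, \<alpha>) \<in> aug_dual_sharp C" using ii that by simp
        moreover have "x \<noteq> 0" using \<open>norm x = 1\<close> by auto
        ultimately have "f x - \<alpha> * norm x > 0"
          using \<open>x \<in> C\<close> by (simp add: aug_dual_sharp_def)
        then show ?thesis using \<open>norm x = 1\<close> by simp
      qed
    qed
    show "f y \<le> \<delta>\<^sub>1" if "y \<in> frontier K" "norm y = 1" for y
    \<comment> \<open>Symmetrically, \<open>\<alpha>\<close> decreases to the left end, with the
      hypothesis applied at \<open>- y\<close>.\<close>
    proof (rule dense_ge_bounded[of _ \<delta>\<^sub>2])
      show "\<delta>\<^sub>1 < \<delta>\<^sub>2" using ii by auto
      have y: "- y \<in> frontier (uminus ` K)" "- y \<noteq> 0"
        using that by (auto simp: frontier_uminus_image)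
      show "f y \<le> \<alpha>" if "\<delta>\<^sub>1 < \<alpha>" "\<alpha> < \<delta>\<^sub>2" for \<alpha>
      proof -
        have "\<alpha> \<in> {\<delta>\<^sub>1<..<\<delta>\<^sub>2}" using that by simp
        with ii y have "0 < f (- y) + \<alpha> * norm (- y)" by blast
        then show ?thesis using \<open>norm y = 1\<close> by (simp add: blinfun.minus_right)
      qed
    qed
  qed
  show ?thesis
  proof (intro conjI iffI)
    show "SSP C K" if "\<exists>\<delta>\<^sub>1 \<delta>\<^sub>2 f. ?ii \<delta>\<^sub>1 \<delta>\<^sub>2 f"
      using that by (elim exE) (rule ii_i)
    show "SSP C K" if "\<exists>\<delta>\<^sub>1 \<delta>\<^sub>2 f. ?iii \<delta>\<^sub>1 \<delta>\<^sub>2 f"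
      using that by (elim exE) (rule ii_i[OF iii_ii])
    assume ssp: "SSP C K"
    show "\<exists>\<delta>\<^sub>1 \<delta>\<^sub>2 f. ?iii \<delta>\<^sub>1 \<delta>\<^sub>2 f" by (rule i_iii[OF ssp])
    then show "\<exists>\<delta>\<^sub>1 \<delta>\<^sub>2 f. ?ii \<delta>\<^sub>1 \<delta>\<^sub>2 f" by (elim exE) (intro exI, rule iii_ii)
  qed
qed

end
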